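(* Let $G$ be the Schläfli graph. Then: (i) the univariate independence polynomial of $G$ is $45t^3+135t^2+27t+1$; (ii) the clique number of $G$ is $\omega=6$; (iii) $\lambda_1(G)\cdot 4\cdot(\omega-1)>-1$.
   Context: The Schläfli graph is the unique strongly regular graph with parameters $(27,16,10,8)$ (27 vertices, 16-regular, adjacent vertices have 10 common neighbors, distinct non-adjacent vertices have 8 common neighbors); it is the complement of the intersection graph of the 27 lines on a smooth cubic surface. The univariate independence polynomial of a graph $G$ is $I(G)(t)=\sum_{S\subseteq V(G),\ S\text{ independent}}t^{|S|}$, and $\lambda_1(G)$ denotes its real root closest to zero (its largest real root, which is negative). The clique number is the number of vertices of a largest clique. *)

theory Defs
  imports "Graph_Theory.Pair_Digraph" "HOL-Computational_Algebra.Polynomial" Complex_Main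
begin

text \<open>
  A finite simple graph is a \<open>pair_graph\<close>, i.e. a finite, loop-free, symmetric digraph
  whose arcs are ordered pairs; an undirected edge is a pair of opposite arcs.
\<close>

definition nbrs :: "'a pair_pre_digraph \<Rightarrow> 'a \<Rightarrow> 'a set" where
  "nbrs G v = {u \<in> pverts G. (v, u) \<in> parcs G}"

definition strongly_regular ::
    "'a pair_pre_digraph \<Rightarrow> nat \<Rightarrow> nat \<Rightarrow> nat \<Rightarrow> nat \<Rightarrow> bool" where
  "strongly_regular G n k l m \<longleftrightarrow>
     pair_graph G \<and> card (pverts G) = n \<and>
     (\<forall>v \<in> pverts G. card (nbrs G v) = k) \<and>
     (\<forall>u \<in> pverts G. \<forall>v \<in> pverts G. (u, v) \<in> parcs G \<longrightarrow> card (nbrs G u \<inter> nbrs G v) = l) \<and>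
     (\<forall>u \<in> pverts G. \<forall>v \<in> pverts G. u \<noteq> v \<and> (u, v) \<notin> parcs G \<longrightarrow>
        card (nbrs G u \<inter> nbrs G v) = m)"

text \<open>
  The parameters below determine a graph up to isomorphism, and ``being the Schlaefli graph''
  means being any representative of that isomorphism class, over any vertex type.
  Such a graph exists: see \<open>schlaefli_graph_27_lines\<close> below.
\<close>

definition is_schlaefli_graph :: "'a pair_pre_digraph \<Rightarrow> bool" where
  "is_schlaefli_graph G \<longleftrightarrow> strongly_regular G 27 16 10 8"

definition indep_set :: "'a pair_pre_digraph \<Rightarrow> 'a set \<Rightarrow> bool" where
  "indep_set G S \<longleftrightarrow> S \<subseteq> pverts G \<and> (\<forall>u \<in> S. \<forall>v \<in> S. (u, v) \<notin> parcs G)"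

definition clique :: "'a pair_pre_digraph \<Rightarrow> 'a set \<Rightarrow> bool" where
  "clique G S \<longleftrightarrow> S \<subseteq> pverts G \<and> (\<forall>u \<in> S. \<forall>v \<in> S. u \<noteq> v \<longrightarrow> (u, v) \<in> parcs G)"

definition clique_number :: "'a pair_pre_digraph \<Rightarrow> nat" where
  "clique_number G = Max (card ` {S. clique G S})"

definition indep_poly :: "'a pair_pre_digraph \<Rightarrow> real poly" where
  "indep_poly G = (\<Sum>S | indep_set G S. monom 1 (card S))"

text \<open>
  The real root closest to zero. It is meaningful whenever \<open>indep_poly G\<close> has a real root; it is
  then negative and the largest real root (\<open>lambda1_props\<close>).
\<close>

definition lambda1 :: "'a pair_pre_digraph \<Rightarrow> real" where
  "lambda1 G = (ARG_MIN abs x. poly (indep_poly G) x = 0)"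

lemma finite_indep_sets:
  assumes "finite (pverts G)"
  shows "finite {S. indep_set G S}"
  by (rule finite_subset[of _ "Pow (pverts G)"]) (auto simp: indep_set_def assms)

lemma poly_indep_poly: "poly (indep_poly G) x = (\<Sum>S | indep_set G S. x ^ card S)"
  by (simp add: indep_poly_def poly_sum poly_monom)

lemma poly_indep_poly_ge_1:
  fixes G :: "'a pair_pre_digraph"
  assumes "finite (pverts G)" "0 \<le> x"
  shows "1 \<le> poly (indep_poly G) x"
proof -
  have "(\<Sum>S\<in>{{} :: 'a set}. x ^ card S) \<le> (\<Sum>S | indep_set G S. x ^ card S)"
    by (rule sum_mono2) (use assms finite_indep_sets in \<open>auto simp: indep_set_def\<close>)
  then show ?thesis by (simp add: poly_indep_poly)
qed

lemma lambda1_props: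
  assumes fin: "finite (pverts G)" and ex: "\<exists>x. poly (indep_poly G) x = 0"
  shows "poly (indep_poly G) (lambda1 G) = 0"
    and "lambda1 G < 0"
    and "lambda1 G = Max {x. poly (indep_poly G) x = 0}"
proof -
  let ?R = "{x. poly (indep_poly G) x = 0}"
  have neg: "x < 0" if "x \<in> ?R" for x
    using poly_indep_poly_ge_1[OF fin, of x] that by (cases "0 \<le> x") auto
  have "indep_poly G \<noteq> 0"
    using poly_indep_poly_ge_1[OF fin, of 0] by auto
  then have finR: "finite ?R" by (rule poly_roots_finite)
  have MR: "Max ?R \<in> ?R" using finR ex by (intro Max_in) auto
  have le: "\<bar>Max ?R\<bar> \<le> \<bar>x\<bar>" if "x \<in> ?R" for x
    using neg[OF that] neg[OF MR] Max_ge[OF finR that] by simp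
  have "lambda1 G = Max ?R"
    unfolding lambda1_def
  proof (rule arg_minI)
    show "poly (indep_poly G) (Max ?R) = 0" using MR by simp
    show "\<not> \<bar>y\<bar> < \<bar>Max ?R\<bar>" if "poly (indep_poly G) y = 0" for y
      using le[of y] that by simp
    fix x assume x: "poly (indep_poly G) x = 0"
      and min: "\<forall>y. poly (indep_poly G) y = 0 \<longrightarrow> \<not> \<bar>y\<bar> < \<bar>x\<bar>"
    have "\<not> \<bar>Max ?R\<bar> < \<bar>x\<bar>" using min MR by simp
    with le[of x] x have "\<bar>x\<bar> = \<bar>Max ?R\<bar>" by simp
    with neg[of x] neg[OF MR] x show "x = Max ?R" by simp
  qed
  with MR neg[OF MR] show "poly (indep_poly G) (lambda1 G) = 0" "lambda1 G < 0"
    "lambda1 G = Max ?R" by auto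
qed

text \<open>
  Existence: the 27 lines on a smooth cubic surface are, in the classical double-six notation,
  \<open>a\<^sub>1, \<dots>, a\<^sub>6\<close>, \<open>b\<^sub>1, \<dots>, b\<^sub>6\<close> and \<open>c\<^sub>i\<^sub>j\<close> for \<open>i < j\<close>. Exactly the following pairs of lines meet:
  \<open>a\<^sub>i, b\<^sub>j\<close> for \<open>i \<noteq> j\<close>; \<open>a\<^sub>i, c\<^sub>j\<^sub>k\<close> and \<open>b\<^sub>i, c\<^sub>j\<^sub>k\<close> for \<open>i \<in> {j, k}\<close>;
  \<open>c\<^sub>i\<^sub>j, c\<^sub>k\<^sub>l\<close> for \<open>{i, j}\<close> and \<open>{k, l}\<close> disjoint.
\<close>

datatype cubic_line = Line_a nat | Line_b nat | Line_c nat nat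

fun meets :: "cubic_line \<Rightarrow> cubic_line \<Rightarrow> bool" where
  "meets (Line_a i) (Line_b j) \<longleftrightarrow> i \<noteq> j"
| "meets (Line_b i) (Line_a j) \<longleftrightarrow> i \<noteq> j"
| "meets (Line_a i) (Line_c j k) \<longleftrightarrow> i = j \<or> i = k"
| "meets (Line_c j k) (Line_a i) \<longleftrightarrow> i = j \<or> i = k"
| "meets (Line_b i) (Line_c j k) \<longleftrightarrow> i = j \<or> i = k"
| "meets (Line_c j k) (Line_b i) \<longleftrightarrow> i = j \<or> i = k"
| "meets (Line_c i j) (Line_c k l) \<longleftrightarrow> i \<noteq> k \<and> i \<noteq> l \<and> j \<noteq> k \<and> j \<noteq> l"
| "meets (Line_a i) (Line_a j) \<longleftrightarrow> False"
| "meets (Line_b i) (Line_b j) \<longleftrightarrow> False"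

definition cubic_lines :: "cubic_line list" where
  "cubic_lines = map Line_a [1..<7] @ map Line_b [1..<7] @ concat (map (\<lambda>i. map (Line_c i) [Suc i..<7]) [1..<7])"

definition lines_graph :: "cubic_line pair_pre_digraph" where
  "lines_graph = \<lparr> pverts = set cubic_lines,
     parcs = {(u, v). u \<in> set cubic_lines \<and> v \<in> set cubic_lines \<and> u \<noteq> v \<and> \<not> meets u v} \<rparr>"

lemma meets_sym: "meets u v \<longleftrightarrow> meets v u"
  by (cases u; cases v) auto

lemma pair_graph_lines_graph: "pair_graph lines_graph"
proof
  show "finite (parcs lines_graph)"
    by (rule finite_subset[of _ "set cubic_lines \<times> set cubic_lines"]) (auto simp: lines_graph_def)
  show "symmetric lines_graph"
    using meets_sym by (auto simp: symmetric_def lines_graph_def sym_def)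
qed (auto simp: lines_graph_def)

lemma distinct_cubic_lines: "distinct cubic_lines" "length cubic_lines = 27"
  by code_simp+

lemma nbrs_lines_graph:
  "v \<in> set cubic_lines \<Longrightarrow>
     nbrs lines_graph v = set (filter (\<lambda>u. u \<noteq> v \<and> \<not> meets v u) cubic_lines)"
  by (auto simp: nbrs_def lines_graph_def)

lemma card_filter_cubic_lines: "card (set (filter P cubic_lines)) = length (filter P cubic_lines)"
  by (simp add: distinct_card distinct_cubic_lines del: set_filter)

lemma count_nbrs:
  "\<forall>v \<in> set cubic_lines. length (filter (\<lambda>u. u \<noteq> v \<and> \<not> meets v u) cubic_lines) = 16"
  by code_simp

lemma count_common_nbrs:
  "\<forall>u \<in> set cubic_lines. \<forall>v \<in> set cubic_lines. u \<noteq> v \<longrightarrow>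
     length (filter (\<lambda>w. (w \<noteq> u \<and> \<not> meets u w) \<and> (w \<noteq> v \<and> \<not> meets v w)) cubic_lines) =
       (if meets u v then 8 else 10)"
  by code_simp

lemma schlaefli_graph_27_lines: "is_schlaefli_graph lines_graph"
proof -
  have deg: "card (nbrs lines_graph v) = 16" if "v \<in> set cubic_lines" for v
    using count_nbrs that by (simp add: nbrs_lines_graph card_filter_cubic_lines del: set_filter)
  have inter: "nbrs lines_graph u \<inter> nbrs lines_graph v =
      set (filter (\<lambda>w. (w \<noteq> u \<and> \<not> meets u w) \<and> (w \<noteq> v \<and> \<not> meets v w)) cubic_lines)"
    if "u \<in> set cubic_lines" "v \<in> set cubic_lines" for u v
    using that by (auto simp: nbrs_lines_graph)
  have common: "card (nbrs lines_graph u \<inter> nbrs lines_graph v) = (if meets u v then 8 else 10)"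
    if "u \<in> set cubic_lines" "v \<in> set cubic_lines" "u \<noteq> v" for u v
    unfolding inter[OF that(1,2)] card_filter_cubic_lines using count_common_nbrs that by blast
  have verts: "pverts lines_graph = set cubic_lines"
    by (simp add: lines_graph_def)
  have arcs: "(u, v) \<in> parcs lines_graph \<longleftrightarrow>
      u \<in> set cubic_lines \<and> v \<in> set cubic_lines \<and> u \<noteq> v \<and> \<not> meets u v" for u v
    by (simp add: lines_graph_def)
  show ?thesis
    unfolding is_schlaefli_graph_def strongly_regular_def verts arcs
    using pair_graph_lines_graph distinct_card[OF distinct_cubic_lines(1)] distinct_cubic_lines(2)
    by (auto simp: deg common)
qed

end

theory Submission
  imports Defs
begin

text \<open>
  The complement of \<open>G\<close> is strongly regular with parameters \<open>(27, 10, 1, 5)\<close>. Every edge of it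
  lies in exactly one triangle, so it has no 4-clique, and extending cliques one vertex at a time
  gives 27 vertices, 135 edges and 45 triangles.

  A coclique of size 6 in the complement consists of a vertex \<open>a\<close> and the five neighbours of some
  \<open>p\<close>, not adjacent to \<open>a\<close>, that are not adjacent to \<open>a\<close>. For the upper bound, with \<open>A\<close> the
  adjacency matrix of the complement, \<open>M = 3I - 3A + J\<close> satisfies \<open>M\<^sup>2 = 18M\<close> and has trace
  \<open>108 = 18 * 6\<close>, hence is positive semidefinite of rank 6, whereas its restriction to a
  coclique is the nonsingular matrix \<open>3I + J\<close>. The rank comparison is carried out by
  summing diagonal entries of a Schur complement.
\<close>

section \<open>Double counting in a hereditary set family\<close>

text \<open>Removing a marked element \<open>v\<close> from \<open>S\<close> is a bijection from
  pairs \<open>(S, v)\<close> with \<open>v\<close> in \<open>S\<close> to pairs of a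
  \<open>k\<close>-set and an extending element; heredity keeps \<open>S - {v}\<close> in
  \<open>F\<close>.\<close>

lemma card_extensions_double_count:
  fixes F :: "'a set set"
  assumes fin: "finite F" and sub: "\<And>S. S \<in> F \<Longrightarrow> finite S"
    and her: "\<And>S T. S \<in> F \<Longrightarrow> T \<subseteq> S \<Longrightarrow> T \<in> F"
  shows "Suc k * card {S \<in> F. card S = Suc k} =
    (\<Sum>T | T \<in> F \<and> card T = k. card {v. v \<notin> T \<and> insert v T \<in> F})"
proof -
  let ?L = "SIGMA S:{S \<in> F. card S = Suc k}. S"
  let ?R = "SIGMA T:{T \<in> F. card T = k}. {v. v \<notin> T \<and> insert v T \<in> F}"
  have finU: "finite (\<Union>F)" using fin sub by auto
  have finE: "finite {v. v \<notin> T \<and> insert v T \<in> F}" for T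
    by (rule finite_subset[OF _ finU]) auto
  have "bij_betw (\<lambda>(S, v). (S - {v}, v)) ?L ?R"
    by (rule bij_betw_byWitness[where f' = "\<lambda>(T, v). (insert v T, v)"])
      (auto simp: insert_absorb sub intro: her)
  then have "card ?L = card ?R" by (rule bij_betw_same_card)
  moreover have "card ?L = Suc k * card {S \<in> F. card S = Suc k}"
    using fin sub by (subst card_SigmaI) auto
  moreover have "card ?R = (\<Sum>T | T \<in> F \<and> card T = k. card {v. v \<notin> T \<and> insert v T \<in> F})"
    using fin finE by (subst card_SigmaI) auto
  ultimately show ?thesis by simp
qed

section \<open>The complement graph and its cliques\<close>

text \<open>Since \<open>N_subset\<close> and \<open>N_sym\<close> hold for all elements of the
  type, \<open>N v\<close> is empty off \<open>V\<close>, and \<open>u \<in> N v\<close> already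
  puts both vertices in \<open>V\<close>.\<close>

locale srg_27_10_1_5 =
  fixes V :: "'a set" and N :: "'a \<Rightarrow> 'a set"
  assumes finite_V: "finite V" and card_V: "card V = 27"
    and N_subset: "N v \<subseteq> V"
    and N_sym: "u \<in> N v \<longleftrightarrow> v \<in> N u"
    and N_irrefl: "v \<notin> N v"
    and card_N: "v \<in> V \<Longrightarrow> card (N v) = 10"
    and card_common_adj: "u \<in> N v \<Longrightarrow> card (N u \<inter> N v) = 1"
    and card_common_nonadj: "u \<in> V \<Longrightarrow> v \<in> V \<Longrightarrow> u \<noteq> v \<Longrightarrow> u \<notin> N v \<Longrightarrow> card (N u \<inter> N v) = 5"
begin

definition cliques :: "'a set set" where
  "cliques = {S. S \<subseteq> V \<and> (\<forall>u \<in> S. \<forall>v \<in> S. u \<noteq> v \<longrightarrow> u \<in> N v)}"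

definition coclique :: "'a set \<Rightarrow> bool" where
  "coclique C \<longleftrightarrow> C \<subseteq> V \<and> (\<forall>u \<in> C. \<forall>v \<in> C. u \<notin> N v)"

lemma finite_N: "finite (N v)"
  using N_subset finite_V by (rule finite_subset)

lemma common_neighbour_unique:
  assumes "u \<in> N v" "x \<in> N u \<inter> N v" "y \<in> N u \<inter> N v"
  shows "x = y"
proof -
  obtain z where "N u \<inter> N v = {z}"
    using card_common_adj[OF assms(1)] by (auto simp: card_1_singleton_iff)
  with assms(2,3) show ?thesis by simp
qed

lemma finite_cliques: "finite cliques"
  by (rule finite_subset[of _ "Pow V"]) (auto simp: cliques_def finite_V)

text \<open>Used for k = 0, 1, 2, this yields the counts 27, 27 * 10 / 2 = 135 and 135 * 1 / 3 =
  45.\<close>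

lemma cliques_extend:
  "(Suc k) * card {S \<in> cliques. card S = Suc k} =
    (\<Sum>T | T \<in> cliques \<and> card T = k. card {v. v \<notin> T \<and> insert v T \<in> cliques})"
  by (rule card_extensions_double_count[OF finite_cliques])
    (auto simp: cliques_def intro: finite_subset[OF _ finite_V])

text \<open>The factor \<open>V\<close> matters for empty \<open>T\<close>, where the intersection
  of the neighbourhoods is the whole type.\<close>

lemma insert_clique:
  assumes "T \<in> cliques"
  shows "{v. v \<notin> T \<and> insert v T \<in> cliques} = V \<inter> (\<Inter>u\<in>T. N u)"
  using assms N_irrefl by (auto simp: cliques_def N_sym)

lemma card_cliques_0: "card {S \<in> cliques. card S = 0} = 1"
proof -
  have "{S \<in> cliques. card S = 0} = {{}}"
    using finite_V by (auto simp: cliques_def dest: finite_subset)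
  then show ?thesis by simp
qed

lemma card_cliques_1: "card {S \<in> cliques. card S = 1} = 27"
proof -
  have "{T. T \<in> cliques \<and> card T = 0} = {{}}"
    using finite_V by (auto simp: cliques_def dest: finite_subset)
  then show ?thesis
    using cliques_extend[of 0] insert_clique[of "{}"] card_V by (simp add: cliques_def)
qed

lemma card_cliques_2: "card {S \<in> cliques. card S = 2} = 135"
proof -
  have "card {v. v \<notin> T \<and> insert v T \<in> cliques} = 10" if T: "T \<in> cliques" "card T = 1" for T
  proof -
    obtain u where "T = {u}" using T(2) by (auto simp: card_1_singleton_iff)
    with T show ?thesis
      using card_N[of u] N_subset[of u] unfolding insert_clique[OF T(1)]
      by (simp add: cliques_def Int_absorb1)
  qed
  then show ?thesis
    using cliques_extend[of 1] card_cliques_1 by (simp add: numeral_2_eq_2)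
qed

lemma card_cliques_3: "card {S \<in> cliques. card S = 3} = 45"
proof -
  have "card {v. v \<notin> T \<and> insert v T \<in> cliques} = 1" if T: "T \<in> cliques" "card T = 2" for T
  proof -
    obtain u w where uw: "T = {u, w}" "u \<noteq> w" using T(2) by (auto simp: card_2_iff)
    then have "u \<in> N w" using T(1) by (auto simp: cliques_def)
    moreover have "V \<inter> (N u \<inter> N w) = N u \<inter> N w" using N_subset by blast
    ultimately show ?thesis
      using card_common_adj unfolding insert_clique[OF T(1)] by (simp add: uw)
  qed
  then show ?thesis
    using cliques_extend[of 2] card_cliques_2 by (simp add: numeral_3_eq_3)
qed

text \<open>In a 4-clique, two vertices would have the other two as distinct common
  neighbours.\<close>

lemma card_clique_le_3:
  assumes "S \<in> cliques"
  shows "card S \<le> 3"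
proof (rule ccontr)
  assume "\<not> card S \<le> 3"
  then obtain T where T: "T \<subseteq> S" "card T = 4"
    using obtain_subset_with_card_n[of 4 S] by force
  then obtain a b c d where "T = {a, b, c, d}" "distinct [a, b, c, d]"
    by (auto simp: card_Suc_eq numeral_eq_Suc)
  moreover from this have "a \<in> N b" "c \<in> N a \<inter> N b" "d \<in> N a \<inter> N b"
    using assms T by (auto simp: cliques_def)
  ultimately show False using common_neighbour_unique[of a b c d] by simp
qed

section \<open>A coclique of size 6\<close>

text \<open>Each vertex of the triangle would share 5 neighbours with \<open>a\<close>. Two of its
  vertices have only the third as common neighbour, and that one is not adjacent to
  \<open>a\<close>, so the three 5-sets are disjoint and \<open>a\<close> would have 15 neighbours
  instead of 10.\<close>

lemma triangle_meets_neighbours: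
  assumes "x \<in> N p" "y \<in> N p" "x \<in> N y" "a \<in> V"
    and "a \<notin> {p, x, y}" "p \<notin> N a" "x \<notin> N a" "y \<notin> N a"
  shows False
proof -
  have V: "p \<in> V" "x \<in> V" "y \<in> V" using assms N_subset N_sym by blast+
  have disj: "N u \<inter> N v \<inter> N a = {}"
    if "u \<in> N v" "w \<in> N u \<inter> N v" "w \<notin> N a" for u v w
    using common_neighbour_unique[OF that(1,2)] that(3) by blast
  have d: "N p \<inter> N x \<inter> N a = {}" "N p \<inter> N y \<inter> N a = {}" "N x \<inter> N y \<inter> N a = {}"
    using disj[of p x y] disj[of p y x] disj[of x y p] assms N_sym by blast+
  have c: "card (N u \<inter> N a) = 5" if "u \<in> {p, x, y}" for u
    using that assms V by (intro card_common_nonadj) auto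
  have "card ((N p \<inter> N a) \<union> (N x \<inter> N a) \<union> (N y \<inter> N a)) = 15"
    using c d finite_N by (subst card_Un_disjoint; (subst card_Un_disjoint)?) auto
  moreover have "card ((N p \<inter> N a) \<union> (N x \<inter> N a) \<union> (N y \<inter> N a)) \<le> card (N a)"
    by (rule card_mono[OF finite_N]) auto
  ultimately show False using card_N[OF assms(4)] by simp
qed

lemma coclique_6_exists: "\<exists>C. coclique C \<and> card C = 6"
proof -
  obtain a where a: "a \<in> V" using card_V by fastforce
  have "card (insert a (N a)) < card V"
    using card_N[OF a] card_V finite_N N_irrefl by simp
  then obtain p where p: "p \<in> V" "p \<noteq> a" "p \<notin> N a"
    by (metis card_mono finite.insertI finite_N insertCI linorder_not_less subsetI)
  have ap: "a \<notin> N p" using p N_sym by blast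
  let ?C = "insert a (N p - N a)"
  have "?C \<subseteq> V" using a N_subset by blast
  \<comment> \<open>An edge inside \<open>N p - N a\<close> would form a triangle with
    \<open>p\<close> that \<open>a\<close> neither belongs to nor touches.\<close>
  moreover have "x \<notin> N y" if "x \<in> N p - N a" "y \<in> N p - N a" for x y
    using triangle_meets_neighbours[of x p y a] that a p ap by blast
  moreover have "a \<notin> N a" "\<And>x. x \<in> N p - N a \<Longrightarrow> a \<notin> N x"
    using N_irrefl N_sym by blast+
  ultimately have "coclique ?C"
    unfolding coclique_def by blast
  moreover have "card (N p - N a) = 10 - 5"
    using card_N[OF p(1)] card_common_nonadj[OF p(1) a p(2,3)] finite_N
    by (simp add: card_Diff_subset_Int)
  then have "card ?C = 6"
    using ap finite_N by simp
  ultimately show ?thesis by blast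
qed

section \<open>The positive semidefinite form and its Schur complements\<close>

text \<open>This is the matrix identity \<open>A\<^sup>2 = 5J + 5I - 4A\<close>, read
  entrywise.\<close>

lemma card_common:
  assumes "u \<in> V" "v \<in> V"
  shows "real (card (N u \<inter> N v)) = 5 + 5 * of_bool (v = u) - 4 * of_bool (v \<in> N u)"
  using assms card_N card_common_adj[of u v] card_common_nonadj[of u v] N_irrefl N_sym
  by (auto simp: of_bool_def)

lemma sum_N_swap:
  fixes f :: "'a \<Rightarrow> 'a \<Rightarrow> real"
  shows "(\<Sum>u\<in>V. \<Sum>v\<in>N u. f u v) = (\<Sum>v\<in>V. \<Sum>u\<in>N v. f u v)"
proof -
  have eq: "{v \<in> V. v \<in> N u} = N u" "{u \<in> V. v \<in> N u} = N v" for u v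
    using N_subset N_sym by blast+
  show ?thesis
    using sum.swap_restrict[OF finite_V finite_V, of f "\<lambda>u v. v \<in> N u"] by (simp only: eq)
qed

lemma sum_N:
  fixes x :: "'a \<Rightarrow> real"
  shows "(\<Sum>u\<in>V. \<Sum>v\<in>N u. x v) = 10 * (\<Sum>v\<in>V. x v)"
  by (subst sum_N_swap) (simp add: card_N sum_distrib_left)

lemma sum_of_bool_N:
  fixes x :: "'a \<Rightarrow> real"
  shows "(\<Sum>v\<in>V. of_bool (v \<in> N u) * x v) = (\<Sum>v\<in>N u. x v)"
proof -
  have "(\<Sum>v\<in>V. of_bool (v \<in> N u) * x v) = (\<Sum>v\<in>V. if v \<in> N u then x v else 0)"
    by (rule sum.cong) auto
  also have "\<dots> = (\<Sum>v\<in>V \<inter> N u. x v)"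
    by (rule sum.inter_restrict[symmetric, OF finite_V])
  finally show ?thesis using N_subset by (simp add: Int_absorb1)
qed

text \<open>By symmetry of \<open>A\<close>, the left side is the quadratic form of
  \<open>A\<^sup>2\<close>, which \<open>card_common\<close> expresses through \<open>J\<close>,
  \<open>I\<close> and \<open>A\<close>.\<close>

lemma sum_N_squared:
  fixes x :: "'a \<Rightarrow> real"
  shows "(\<Sum>u\<in>V. (\<Sum>v\<in>N u. x v)\<^sup>2) =
    5 * (\<Sum>v\<in>V. x v)\<^sup>2 + 5 * (\<Sum>v\<in>V. (x v)\<^sup>2) - 4 * (\<Sum>u\<in>V. x u * (\<Sum>v\<in>N u. x v))"
proof -
  let ?a = "\<lambda>u v. of_bool (v \<in> N u) :: real"
  have "(\<Sum>u\<in>V. (\<Sum>v\<in>N u. x v)\<^sup>2)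
      = (\<Sum>u\<in>V. \<Sum>v\<in>V. \<Sum>w\<in>V. (?a u v * x v) * (?a u w * x w))"
    by (simp only: sum_of_bool_N[symmetric] power2_eq_square sum_product)
  also have "\<dots> = (\<Sum>v\<in>V. \<Sum>w\<in>V. \<Sum>u\<in>V. (?a u v * x v) * (?a u w * x w))"
    by (subst sum.swap, rule sum.cong[OF refl], rule sum.swap)
  also have "\<dots> = (\<Sum>v\<in>V. \<Sum>w\<in>V. x v * x w * real (card (N v \<inter> N w)))"
  proof (intro sum.cong refl)
    fix v w
    have "(\<Sum>u\<in>V. (?a u v * x v) * (?a u w * x w))
        = (\<Sum>u\<in>V. if u \<in> N v \<inter> N w then x v * x w else 0)"
      by (intro sum.cong) (use N_sym in auto)
    also have "\<dots> = (\<Sum>u\<in>V \<inter> (N v \<inter> N w). x v * x w)"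
      by (rule sum.inter_restrict[symmetric, OF finite_V])
    also have "V \<inter> (N v \<inter> N w) = N v \<inter> N w" using N_subset by blast
    finally show "(\<Sum>u\<in>V. (?a u v * x v) * (?a u w * x w))
        = x v * x w * real (card (N v \<inter> N w))" by (simp add: mult.commute)
  qed
  also have "\<dots> = (\<Sum>v\<in>V. \<Sum>w\<in>V. 5 * (x v * x w) + 5 * (if w = v then x v * x w else 0)
      - 4 * (x v * (?a v w * x w)))"
    by (intro sum.cong refl) (auto simp: card_common algebra_simps)
  also have "\<dots> = 5 * (\<Sum>v\<in>V. \<Sum>w\<in>V. x v * x w) + 5 * (\<Sum>v\<in>V. x v * x v)
      - 4 * (\<Sum>v\<in>V. x v * (\<Sum>w\<in>V. ?a v w * x w))"
    using finite_V
    by (simp add: sum.distrib sum_subtractf sum_distrib_left[symmetric])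
  finally show ?thesis
    by (simp add: sum_of_bool_N power2_eq_square sum_product)
qed

text \<open>With \<open>M = 3I - 3A + J\<close>, this is \<open>x\<^sup>T M x = |M x|\<^sup>2 / 18\<close>.\<close>

lemma quadratic_form_nonneg:
  fixes x :: "'a \<Rightarrow> real"
  shows "0 \<le> 3 * (\<Sum>v\<in>V. (x v)\<^sup>2) - 3 * (\<Sum>u\<in>V. x u * (\<Sum>v\<in>N u. x v)) + (\<Sum>v\<in>V. x v)\<^sup>2"
proof -
  define X where "X = (\<Sum>v\<in>V. x v)"
  define s where "s u = (\<Sum>v\<in>N u. x v)" for u
  have "0 \<le> (\<Sum>u\<in>V. (3 * x u - 3 * s u + X)\<^sup>2)"
    by (rule sum_nonneg) simp
  also have "\<dots> = (\<Sum>u\<in>V. 9 * (x u)\<^sup>2 + 9 * (s u)\<^sup>2 + X\<^sup>2 - 18 * (x u * s u)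
      + 6 * X * x u - 6 * X * s u)"
    by (intro sum.cong refl) (simp add: power2_eq_square algebra_simps)
  also have "\<dots> = 9 * (\<Sum>u\<in>V. (x u)\<^sup>2) + 9 * (\<Sum>u\<in>V. (s u)\<^sup>2) + 27 * X\<^sup>2
      - 18 * (\<Sum>u\<in>V. x u * s u) + 6 * X * (\<Sum>u\<in>V. x u) - 6 * X * (\<Sum>u\<in>V. s u)"
    by (simp add: sum.distrib sum_subtractf sum_distrib_left[symmetric] card_V)
  \<comment> \<open>Here \<open>M\<^sup>2 = 18M\<close> appears: the terms in \<open>s\<close> are
    replaced using \<open>A\<^sup>2 = 5J + 5I - 4A\<close> and row sums 10.\<close>
  also have "\<dots> = 18 * (3 * (\<Sum>v\<in>V. (x v)\<^sup>2) - 3 * (\<Sum>u\<in>V. x u * s u) + X\<^sup>2)"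
    using sum_N_squared[of x] sum_N[of x]
    by (simp add: s_def[symmetric] X_def[symmetric] power2_eq_square)
  finally show ?thesis by (simp add: s_def X_def)
qed

text \<open>
  Up to the positive factor \<open>k + 3\<close>, the Schur complement of the block \<open>3I + J\<close> of \<open>M\<close> at \<open>w\<close>;
  the test vector is the minimiser of the quadratic form.
\<close>

lemma coclique_outside_vertex:
  assumes C: "coclique C" and w: "w \<in> V" "w \<notin> C"
  defines "k \<equiv> real (card C)" and "d \<equiv> real (card (N w \<inter> C))"
  shows "0 \<le> 3 * d\<^sup>2 - (3 * k + 3) * d + (3 * k + 12)"
proof -
  let ?D = "N w \<inter> C"
  have ind: "u \<notin> N v" if "u \<in> C" "v \<in> C" for u v
    using C that by (auto simp: coclique_def)
  have CV: "C \<subseteq> V" using C by (auto simp: coclique_def)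
  have finC: "finite C" using CV finite_V by (rule finite_subset)
  have finD: "finite ?D" using finC by simp
  have w0: "w \<notin> N w" by (rule N_irrefl)
  \<comment> \<open>Column \<open>w\<close> of \<open>M\<close> is -2 on \<open>?D\<close> and 1 on
    the rest of \<open>C\<close>. With \<open>x w = k + 3\<close>, chosen to clear denominators, the
    values on \<open>C\<close> solve \<open>(3I + J) x = - (k + 3) m\<close>, where \<open>m\<close>
    is that column restricted to \<open>C\<close>.\<close>
  define x where "x v = (k + 3) * (of_bool (v = w) + of_bool (v \<in> ?D)) - (1 + d) * of_bool (v \<in> C)" for v
  have x_w: "x w = k + 3" using w by (simp add: x_def)
  have x_D: "x v = k + 2 - d" if "v \<in> ?D" for v using that w by (auto simp: x_def)
  have x_CD: "x v = - (1 + d)" if "v \<in> C - ?D" for v using that w by (auto simp: x_def)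
  have x_0: "x v = 0" if "v \<notin> insert w C" for v using that by (auto simp: x_def)
  have cardCD: "real (card (C - ?D)) = k - d"
    using finC finD by (simp add: card_Diff_subset k_def d_def card_mono)
  \<comment> \<open>All three sums in the quadratic form have terms that are constant on the blocks
    \<open>{w}\<close>, \<open>?D\<close> and \<open>C - ?D\<close>, of sizes 1, \<open>d\<close>
    and \<open>k - d\<close>.\<close>
  have sum_blocks: "(\<Sum>v\<in>V. f v) = a + d * b + (k - d) * c"
    if "f w = a" "\<And>v. v \<in> ?D \<Longrightarrow> f v = b" "\<And>v. v \<in> C - ?D \<Longrightarrow> f v = c"
      "\<And>v. v \<notin> insert w C \<Longrightarrow> f v = 0" for f :: "'a \<Rightarrow> real" and a b c
  proof -
    have "(\<Sum>v\<in>V. f v) = (\<Sum>v\<in>insert w C. f v)"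
      using that(4) CV w by (intro sum.mono_neutral_right finite_V) auto
    also have "\<dots> = f w + (\<Sum>v\<in>C. f v)" using finC w by simp
    also have "(\<Sum>v\<in>C. f v) = (\<Sum>v\<in>C - ?D. f v) + (\<Sum>v\<in>?D. f v)"
      by (rule sum.subset_diff[OF _ finC]) auto
    also have "(\<Sum>v\<in>?D. f v) = d * b"
      using that(2) by (simp add: d_def)
    also have "(\<Sum>v\<in>C - ?D. f v) = (\<Sum>v\<in>C - ?D. c)"
      by (rule sum.cong[OF refl that(3)])
    also have "\<dots> = (k - d) * c"
      by (simp only: sum_constant cardCD)
    finally show ?thesis using that(1) by simp
  qed
  have nb: "(\<Sum>v\<in>N u. x v) = (\<Sum>v\<in>N u \<inter> insert w C. x v)" for u
    using x_0 by (intro sum.mono_neutral_right finite_N) auto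
  have s_w: "(\<Sum>v\<in>N w. x v) = d * (k + 2 - d)"
  proof -
    have "N w \<inter> insert w C = ?D" using w0 by auto
    then show ?thesis using x_D by (simp add: nb d_def)
  qed
  have s_D: "(\<Sum>v\<in>N u. x v) = k + 3" if "u \<in> ?D" for u
  proof -
    have "N u \<inter> insert w C = {w}" using that ind N_sym by auto
    then show ?thesis using x_w by (simp add: nb)
  qed
  have s_CD: "(\<Sum>v\<in>N u. x v) = 0" if "u \<in> C - ?D" for u
  proof -
    have "N u \<inter> insert w C = {}" using that ind N_sym by auto
    then show ?thesis by (simp add: nb)
  qed
  have "(\<Sum>v\<in>V. x v) = (k + 3) + d * (k + 2 - d) + (k - d) * - (1 + d)"
    by (rule sum_blocks) (rule x_w x_D x_CD x_0, assumption?)+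
  moreover have "(\<Sum>v\<in>V. (x v)\<^sup>2) = (k + 3)\<^sup>2 + d * (k + 2 - d)\<^sup>2 + (k - d) * (- (1 + d))\<^sup>2"
    by (rule sum_blocks) (simp_all only: x_w x_D x_CD x_0 power2_eq_square mult_zero_left not_False_eq_True)
  moreover have "(\<Sum>u\<in>V. x u * (\<Sum>v\<in>N u. x v))
      = (k + 3) * (d * (k + 2 - d)) + d * ((k + 2 - d) * (k + 3)) + (k - d) * 0"
    by (rule sum_blocks)
      (simp_all only: x_w x_D x_0 s_w s_D s_CD mult_zero_left mult_zero_right not_False_eq_True)
  ultimately have "0 \<le> (k + 3) * (3 * d\<^sup>2 - (3 * k + 3) * d + (3 * k + 12))"
    using quadratic_form_nonneg[of x] by (simp add: power2_eq_square algebra_simps)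
  moreover have "0 < k + 3" by (simp add: k_def add_nonneg_pos)
  ultimately show ?thesis by (simp add: zero_le_mult_iff)
qed

section \<open>Upper bound for cocliques\<close>

text \<open>The bound of \<open>coclique_outside_vertex\<close> is summed over all \<open>w\<close>
  outside \<open>C\<close>. It is quadratic in \<open>d w\<close>, and the first two moments of
  \<open>d\<close> depend on \<open>k\<close> alone; the total factors as
  \<open>18 * (k + 3) * (6 - k)\<close>.\<close>

lemma card_coclique_le_6:
  assumes C: "coclique C"
  shows "card C \<le> 6"
proof -
  define k where "k = real (card C)"
  define d where "d w = real (card (N w \<inter> C))" for w
  have CV: "C \<subseteq> V" using C by (auto simp: coclique_def)
  have finC: "finite C" using CV finite_V by (rule finite_subset)
  let ?x = "\<lambda>v. of_bool (v \<in> C) :: real"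
  have d: "(\<Sum>v\<in>N w. ?x v) = d w" for w
    by (simp add: d_def finite_N Int_def)
  have d_C: "d w = 0" if "w \<in> C" for w
  proof -
    have "N w \<inter> C = {}" using C that by (auto simp: coclique_def)
    then show ?thesis by (simp add: d_def)
  qed
  have X: "(\<Sum>v\<in>V. ?x v) = k" "(\<Sum>v\<in>V. (?x v)\<^sup>2) = k"
    using CV finite_V by (simp_all add: k_def Int_absorb1 power2_eq_square flip: of_bool_conj Int_def)
  \<comment> \<open>A coclique spans no edge, so the term in \<open>A\<close> of
    \<open>sum_N_squared\<close> vanishes.\<close>
  have "(\<Sum>u\<in>V. ?x u * d u) = 0"
    by (rule sum.neutral) (simp add: d_C)
  then have sum_d: "(\<Sum>u\<in>V. d u) = 10 * k" "(\<Sum>u\<in>V. (d u)\<^sup>2) = 5 * k\<^sup>2 + 5 * k - 4 * 0"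
    using sum_N[of ?x] sum_N_squared[of ?x] by (simp_all only: d X)
  have "0 \<le> (\<Sum>w\<in>V - C. 3 * (d w)\<^sup>2 - (3 * k + 3) * d w + (3 * k + 12))"
    using coclique_outside_vertex[OF C] by (intro sum_nonneg) (auto simp: k_def d_def)
  also have "\<dots> = 3 * (\<Sum>w\<in>V - C. (d w)\<^sup>2) - (3 * k + 3) * (\<Sum>w\<in>V - C. d w)
      + (27 - k) * (3 * k + 12)"
    using finC CV card_V card_mono[OF finite_V CV]
    by (simp add: sum.distrib sum_subtractf sum_distrib_left[symmetric] card_Diff_subset k_def)
  \<comment> \<open>As \<open>d\<close> is zero on \<open>C\<close>, the sums extend to all of
    \<open>V\<close>, where the moments are known.\<close>
  also have "(\<Sum>w\<in>V - C. (d w)\<^sup>2) = (\<Sum>w\<in>V. (d w)\<^sup>2)"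
    by (rule sum.mono_neutral_left[OF finite_V]) (auto simp: d_C)
  also have "(\<Sum>w\<in>V - C. d w) = (\<Sum>w\<in>V. d w)"
    by (rule sum.mono_neutral_left[OF finite_V]) (auto simp: d_C)
  finally have "0 \<le> 18 * (k + 3) * (6 - k)"
    unfolding sum_d by (simp add: power2_eq_square algebra_simps)
  moreover have "0 < 18 * (k + 3)" by (simp add: k_def add_nonneg_pos)
  ultimately have "k \<le> 6" by (simp add: zero_le_mult_iff)
  then show ?thesis by (simp add: k_def)
qed

end

section \<open>Passing from the Schlaefli graph to its complement\<close>

text \<open>Common neighbours in the complement are the vertices outside both closed neighbourhoods
  in \<open>G\<close>, counted by inclusion-exclusion. Requiring \<open>v\<close> in
  \<open>pverts G\<close> makes the relation symmetric on the whole type.\<close>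

lemma srg_complement:
  fixes G :: "'a pair_pre_digraph"
  assumes "is_schlaefli_graph G"
  shows "srg_27_10_1_5 (pverts G) (\<lambda>v. {u \<in> pverts G. v \<in> pverts G \<and> u \<noteq> v \<and> (v, u) \<notin> parcs G})"
proof -
  let ?V = "pverts G"
  let ?N = "\<lambda>v. {u \<in> ?V. v \<in> ?V \<and> u \<noteq> v \<and> (v, u) \<notin> parcs G}"
  have pg: "pair_graph G" and cV: "card ?V = 27"
    and deg: "\<And>v. v \<in> ?V \<Longrightarrow> card (nbrs G v) = 16"
    and adj: "\<And>u v. u \<in> ?V \<Longrightarrow> v \<in> ?V \<Longrightarrow> (u, v) \<in> parcs G \<Longrightarrow> card (nbrs G u \<inter> nbrs G v) = 10"
    and nonadj: "\<And>u v. u \<in> ?V \<Longrightarrow> v \<in> ?V \<Longrightarrow> u \<noteq> v \<Longrightarrow> (u, v) \<notin> parcs G \<Longrightarrow>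
        card (nbrs G u \<inter> nbrs G v) = 8"
    using assms unfolding is_schlaefli_graph_def strongly_regular_def by blast+
  interpret pair_graph G by (rule pg)
  have irr: "(v, v) \<notin> parcs G" for v
    using no_loops by fastforce
  have sym: "(u, v) \<in> parcs G \<longleftrightarrow> (v, u) \<in> parcs G" for u v
    using sym_arcs by (auto simp: symmetric_def sym_def)
  have finV: "finite ?V" by (rule pair_finite_verts)
  have nb: "nbrs G v \<subseteq> ?V" "finite (nbrs G v)" "v \<notin> nbrs G v" for v
    using finV irr by (auto simp: nbrs_def)
  have N: "?N v = ?V - insert v (nbrs G v)" if "v \<in> ?V" for v
    using that by (auto simp: nbrs_def)
  have cardN: "card (?N v) = 10" if "v \<in> ?V" for v
    unfolding N[OF that] using that nb deg cV by (subst card_Diff_subset) auto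
  have NN: "?N u \<inter> ?N v = ?V - (insert u (nbrs G u) \<union> insert v (nbrs G v))"
    if "u \<in> ?V" "v \<in> ?V" for u v
    using that by (auto simp: nbrs_def)
  have cardU: "card (nbrs G u \<union> nbrs G v) = 32 - card (nbrs G u \<inter> nbrs G v)"
    if "u \<in> ?V" "v \<in> ?V" for u v
    using card_Un_Int[of "nbrs G u" "nbrs G v"] nb deg that by simp
  have common5: "card (?N u \<inter> ?N v) = 5" if "u \<in> ?V" "v \<in> ?V" "(u, v) \<in> parcs G" for u v
  proof -
    \<comment> \<open>Adjacent vertices lie in each other's neighbourhoods, so the union has 32 - 10
      = 22 elements, leaving 5.\<close>
    have "insert u (nbrs G u) \<union> insert v (nbrs G v) = nbrs G u \<union> nbrs G v"
      using that sym by (auto simp: nbrs_def)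
    then show ?thesis
      unfolding NN[OF that(1,2)] using nb cV cardU[OF that(1,2)] adj[OF that]
      by (simp add: card_Diff_subset)
  qed
  have common1: "card (?N u \<inter> ?N v) = 1"
    if "u \<in> ?V" "v \<in> ?V" "u \<noteq> v" "(u, v) \<notin> parcs G" for u v
  proof -
    \<comment> \<open>Here \<open>u\<close> and \<open>v\<close> are two extra elements: 32 - 8 + 2
      = 26, leaving 1.\<close>
    have eq: "insert u (nbrs G u) \<union> insert v (nbrs G v) = insert u (insert v (nbrs G u \<union> nbrs G v))"
      by auto
    have "u \<notin> insert v (nbrs G u \<union> nbrs G v)" "v \<notin> nbrs G u \<union> nbrs G v"
      using that sym irr by (auto simp: nbrs_def)
    then have "card (insert u (nbrs G u) \<union> insert v (nbrs G v)) = 26"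
      unfolding eq using nb cardU[OF that(1,2)] nonadj[OF that] by simp
    moreover have "insert u (nbrs G u) \<union> insert v (nbrs G v) \<subseteq> ?V" using nb that by auto
    ultimately show ?thesis
      unfolding NN[OF that(1,2)] using nb cV by (simp add: card_Diff_subset)
  qed
  show ?thesis
  proof
    show "card (?N u \<inter> ?N v) = 1" if "u \<in> ?N v" for u v
      using that sym by (intro common1) auto
    show "card (?N u \<inter> ?N v) = 5" if "u \<in> ?V" "v \<in> ?V" "u \<noteq> v" "u \<notin> ?N v" for u v
      using that sym by (intro common5) auto
    show "card (?N v) = 10" if "v \<in> ?V" for v using that by (rule cardN)
  qed (use finV cV sym in auto)
qed

lemma coeff_indep_poly:
  assumes "finite (pverts G)"
  shows "coeff (indep_poly G) n = real (card {S. indep_set G S \<and> card S = n})"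
proof -
  have "coeff (indep_poly G) n = (\<Sum>S | indep_set G S. if card S = n then 1 else 0)"
    by (simp add: indep_poly_def coeff_sum)
  then show ?thesis
    using finite_indep_sets[OF assms] by (simp add: sum.If_cases Int_def)
qed

section \<open>Polynomial, clique number and root bound\<close>

theorem lemma5p1:
  fixes G :: "'a pair_pre_digraph"
  assumes "is_schlaefli_graph G"
  shows "indep_poly G = [:1, 27, 135, 45:]
       \<and> clique_number G = 6
       \<and> lambda1 G * 4 * (real (clique_number G) - 1) > -1"
proof -
  let ?N = "\<lambda>v. {u \<in> pverts G. v \<in> pverts G \<and> u \<noteq> v \<and> (v, u) \<notin> parcs G}"
  interpret H: srg_27_10_1_5 "pverts G" ?N
    by (rule srg_complement[OF assms])
  interpret pair_graph G
    using assms by (simp add: is_schlaefli_graph_def strongly_regular_def)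
  have irr: "(v, v) \<notin> parcs G" for v
    using no_loops by fastforce
  have sym: "(u, v) \<in> parcs G \<longleftrightarrow> (v, u) \<in> parcs G" for u v
    using sym_arcs by (auto simp: symmetric_def sym_def)
  have "indep_set G S \<longleftrightarrow> S \<in> H.cliques" for S
    by (auto simp: indep_set_def H.cliques_def) (metis irr)+
  then have c: "coeff (indep_poly G) n = real (card {S \<in> H.cliques. card S = n})" for n
    by (simp add: coeff_indep_poly[OF H.finite_V])
  have poly: "indep_poly G = [:1, 27, 135, 45:]"
  proof (rule poly_eqI)
    fix n :: nat
    consider "n = 0" | "n = 1" | "n = 2" | "n = 3" | "n > 3" by linarith
    then show "coeff (indep_poly G) n = coeff [:1, 27, 135, 45:] n"
    proof cases
      case 5
      then have "{S \<in> H.cliques. card S = n} = {}" using H.card_clique_le_3 by fastforce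
      then have "coeff (indep_poly G) n = 0" by (simp only: c card.empty of_nat_0)
      with 5 show ?thesis by (simp add: coeff_pCons split: nat.split)
    qed (simp_all only: c H.card_cliques_0 H.card_cliques_1 H.card_cliques_2 H.card_cliques_3,
        simp_all add: numeral_eq_Suc)
  qed
  have clique: "clique G S \<longleftrightarrow> H.coclique S" for S
    by (auto simp: clique_def H.coclique_def irr)
  have omega: "clique_number G = 6"
    unfolding clique_number_def clique
  proof (rule Max_eqI)
    show "finite (card ` {S. H.coclique S})"
      by (rule finite_subset[of _ "{..6}"]) (use H.card_coclique_le_6 in auto)
  qed (use H.card_coclique_le_6 H.coclique_6_exists in force)+
  \<comment> \<open>Since 4 * (6 - 1) = 20, a root above -1/20 is wanted. The polynomial is negative
    at -1/20 (about -0.018) and equals 1 at 0.\<close>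
  have "\<exists>x. -1/20 \<le> x \<and> x \<le> 0 \<and> poly (indep_poly G) x = 0"
    by (rule IVT) (simp_all add: poly)
  then obtain x where x: "-1/20 \<le> x" "poly (indep_poly G) x = 0" by blast
  moreover have "poly (indep_poly G) (-1/20) \<noteq> 0" by (simp add: poly)
  ultimately have "-1/20 < x" by (metis order_le_less)
  moreover have "finite {x. poly (indep_poly G) x = 0}"
    by (rule poly_roots_finite) (simp add: poly)
  \<comment> \<open>\<open>lambda1 G\<close> is the largest real root, so any root bounds it from
    below.\<close>
  then have "x \<le> lambda1 G"
    using lambda1_props(3)[OF H.finite_V exI, OF x(2)] x(2) by simp
  ultimately show ?thesis using poly omega by simp
qed

end
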